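(* Let $n\ge 2$ and let $\mathcal{S}=\{\rho_1,\dots,\rho_N\}$ be a finite set of mutually orthogonal (possibly mixed) states of an $n$-partite quantum system on $\bigotimes_{k=1}^n\mathbb{C}^{d_k}$. If $\rho_j\in\mathcal{S}$ is a pure product state, i.e. $\rho_j=|\psi_j\rangle\langle\psi_j|$ with $|\psi_j\rangle=\bigotimes_{k=1}^n|\xi_k\rangle$, $|\xi_k\rangle\in\mathbb{C}^{d_k}$, then $\rho_j$ can be authenticated locally in $\mathcal{S}$, i.e. the question $\mathcal{Q}_j$ can be perfectly answered under LOCC.
   Context: An $n$-partite system ($n\ge 2$) has Hilbert space $\bigotimes_{k=1}^n\mathbb{C}^{d_k}$, each tensor factor being held by a different spatially separated party $B_k$. A state is a density operator on this space (pure states $|\psi\rangle$ are identified with $|\psi\rangle\langle\psi|$); states $\rho,\sigma$ are orthogonal if $\operatorname{Tr}(\rho\sigma)=0$. LOCC has its standard meaning: a protocol with finitely many rounds of local quantum measurements by individual parties and classical communication among all of them; a POVM is LOCC-implementable if its outcome statistics are produced by such a protocol (including classical post-processing). For a set $\mathcal{S}=\{\rho_1,\dots,\rho_N\}$, an unknown element of which is shared by the parties, the question $\mathcal{Q}_i$ is "is the shared state $\rho_i$ or not?". The question $\mathcal{Q}_i$ can be perfectly answered under LOCC (equivalently, $\rho_i$ can be authenticated locally in $\mathcal{S}$) if there is a two-outcome LOCC-implementable POVM $\{M_i^{(0)},M_i^{(1)}\}$ with $\operatorname{Tr}(M_i^{(1)}\rho_i)=1$ and $\operatorname{Tr}(M_i^{(1)}\rho_j)=0$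 for all $j\ne i$. *)

theory Defs
  imports "Jordan_Normal_Form.Schur_Decomposition"
begin

section \<open>Matrices\<close>

definition mat_trace :: "complex mat \<Rightarrow> complex" where
  "mat_trace A = (\<Sum>i<dim_row A. A $$ (i, i))"

definition mat_sum :: "nat \<Rightarrow> ('a \<Rightarrow> complex mat) \<Rightarrow> 'a set \<Rightarrow> complex mat" where
  "mat_sum D f S = mat D D (\<lambda>ij. \<Sum>a\<in>S. f a $$ ij)"

(* On complex numbers, 0 \<le> z means that z is real and nonnegative; hence a positive
   matrix is in particular Hermitian. *)
definition positive_mat :: "nat \<Rightarrow> complex mat \<Rightarrow> bool" where
  "positive_mat D A \<longleftrightarrow>
     A \<in> carrier_mat D D \<and> (\<forall>v \<in> carrier_vec D. 0 \<le> (A *\<^sub>v v) \<bullet>c v)"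

definition rank_one_op :: "complex vec \<Rightarrow> complex mat" where
  "rank_one_op \<psi> = mat (dim_vec \<psi>) (dim_vec \<psi>) (\<lambda>(i, j). \<psi> $ i * cnj (\<psi> $ j))"


section \<open>Tensor products\<close>

text \<open>The parties are numbered \<open>0, \<dots>, n - 1\<close>, and \<open>d k\<close> is the local dimension of party \<open>k\<close>.
  The joint space is identified with complex vectors of length \<open>\<Prod>k<n. d k\<close> through the Kronecker
  product, the factor of party \<open>0\<close> being the most significant digit of an index.\<close>

definition total_dim :: "nat \<Rightarrow> (nat \<Rightarrow> nat) \<Rightarrow> nat" where
  "total_dim n d = (\<Prod>k<n. d k)"

definition kron_mat :: "complex mat \<Rightarrow> complex mat \<Rightarrow> complex mat" where
  "kron_mat A B = mat (dim_row A * dim_row B) (dim_col A * dim_col B)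
     (\<lambda>(i, j). A $$ (i div dim_row B, j div dim_col B) * B $$ (i mod dim_row B, j mod dim_col B))"

definition kron_vec :: "complex vec \<Rightarrow> complex vec \<Rightarrow> complex vec" where
  "kron_vec v w = vec (dim_vec v * dim_vec w) (\<lambda>i. v $ (i div dim_vec w) * w $ (i mod dim_vec w))"

primrec tensor_mat :: "nat \<Rightarrow> (nat \<Rightarrow> complex mat) \<Rightarrow> complex mat" where
  "tensor_mat 0 A = 1\<^sub>m 1"
| "tensor_mat (Suc n) A = kron_mat (tensor_mat n A) (A n)"

primrec tensor_vec :: "nat \<Rightarrow> (nat \<Rightarrow> complex vec) \<Rightarrow> complex vec" where
  "tensor_vec 0 \<xi> = vec 1 (\<lambda>_. 1)"
| "tensor_vec (Suc n) \<xi> = kron_vec (tensor_vec n \<xi>) (\<xi> n)"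

definition local_op :: "nat \<Rightarrow> (nat \<Rightarrow> nat) \<Rightarrow> nat \<Rightarrow> complex mat \<Rightarrow> complex mat" where
  "local_op n d k K = tensor_mat n (\<lambda>l. if l = k then K else 1\<^sub>m (d l))"


section \<open>States and measurements\<close>

definition density_op :: "nat \<Rightarrow> complex mat \<Rightarrow> bool" where
  "density_op D \<rho> \<longleftrightarrow> positive_mat D \<rho> \<and> mat_trace \<rho> = 1"

definition orthogonal_states :: "complex mat \<Rightarrow> complex mat \<Rightarrow> bool" where
  "orthogonal_states \<rho> \<sigma> \<longleftrightarrow> mat_trace (\<rho> * \<sigma>) = 0"

definition povm :: "nat \<Rightarrow> ('o::finite \<Rightarrow> complex mat) \<Rightarrow> bool" where
  "povm D M \<longleftrightarrow> (\<forall>x. positive_mat D (M x)) \<and> mat_sum D M UNIV = 1\<^sub>m D"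


section \<open>LOCC protocols\<close>

text \<open>\<open>Measure k m K P\<close> lets party \<open>k\<close> perform the local measurement with outcomes \<open>a < m\<close> and
  measurement operators \<open>K a\<close>, and broadcast the outcome \<open>a\<close>; all parties then continue with \<open>P a\<close>.
  The values of \<open>K\<close> and \<open>P\<close> at arguments \<open>a \<ge> m\<close> are irrelevant, so a protocol is a finitely
  branching, well-founded tree and has finitely many rounds. Every leaf announces a final
  outcome depending on the whole history, which is the classical post-processing. The operators
  need not be square: a party may attach or discard local subsystems. Coarse-grained local
  instruments arise when the continuation does not depend on part of the outcome, and local
  randomness arises from multiples of the identity.\<close>

datatype 'o locc =
  Output 'o
| Measure nat nat "nat \<Rightarrow> complex mat" "nat \<Rightarrow> 'o locc"

primrec valid_locc :: "nat \<Rightarrow> 'o locc \<Rightarrow> (nat \<Rightarrow> nat) \<Rightarrow> bool" where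
  "valid_locc n (Output x) d \<longleftrightarrow> True"
| "valid_locc n (Measure k m K P) d \<longleftrightarrow>
     k < n \<and>
     (\<forall>a<m. dim_col (K a) = d k) \<and>
     mat_sum (d k) (\<lambda>a. mat_adjoint (K a) * K a) {..<m} = 1\<^sub>m (d k) \<and>
     (\<forall>a<m. valid_locc n (P a) (d(k := dim_row (K a))))"

text \<open>The probability that the protocol announces \<open>x\<close>. The recursion passes on unnormalized
  post-measurement states, whose trace carries the probability of the history so far.\<close>

primrec locc_prob :: "nat \<Rightarrow> 'o locc \<Rightarrow> (nat \<Rightarrow> nat) \<Rightarrow> complex mat \<Rightarrow> 'o \<Rightarrow> complex" where
  "locc_prob n (Output y) d \<rho> x = (if x = y then mat_trace \<rho> else 0)"
| "locc_prob n (Measure k m K P) d \<rho> x =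
     (\<Sum>a<m. locc_prob n (P a) (d(k := dim_row (K a)))
        (local_op n d k (K a) * \<rho> * mat_adjoint (local_op n d k (K a))) x)"

definition locc_implementable :: "nat \<Rightarrow> (nat \<Rightarrow> nat) \<Rightarrow> ('o \<Rightarrow> complex mat) \<Rightarrow> bool" where
  "locc_implementable n d M \<longleftrightarrow>
     (\<exists>P. valid_locc n P d \<and>
        (\<forall>\<rho> x. density_op (total_dim n d) \<rho> \<longrightarrow> locc_prob n P d \<rho> x = mat_trace (M x * \<rho>)))"

text \<open>The set of states is given as a family \<open>\<rho> i\<close>, \<open>i < N\<close>; the outcome \<open>True\<close> is the answer
  that the shared state is \<open>\<rho> i\<close>.\<close>

definition locally_authenticable ::
  "nat \<Rightarrow> (nat \<Rightarrow> nat) \<Rightarrow> nat \<Rightarrow> (nat \<Rightarrow> complex mat) \<Rightarrow> nat \<Rightarrow> bool" where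
  "locally_authenticable n d N \<rho> i \<longleftrightarrow>
     (\<exists>M :: bool \<Rightarrow> complex mat.
        povm (total_dim n d) M \<and> locc_implementable n d M \<and>
        mat_trace (M True * \<rho> i) = 1 \<and>
        (\<forall>j<N. j \<noteq> i \<longrightarrow> mat_trace (M True * \<rho> j) = 0))"

end

theory Submission
  imports Defs
begin

text \<open>Since \<open>\<rho> j\<close> is a state, it equals the tensor product of the rank-one projections onto the local
  vectors \<open>\<xi> k\<close>. The parties measure these projections one after another and answer yes iff all
  of them succeed: the resulting measurement is \<open>\<rho> j\<close> itself against its complement, and the
  probability of a yes on \<open>\<rho> i\<close> is the trace of \<open>\<rho> j * \<rho> i\<close>.\<close>

section \<open>Adjoint and trace\<close>

lemma mat_adjoint_carrier [simp]: "A \<in> carrier_mat a b \<Longrightarrow> mat_adjoint A \<in> carrier_mat b a"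
  by (auto simp: mat_adjoint_def)

lemma dim_mat_adjoint [simp]:
  "dim_row (mat_adjoint A) = dim_col A" "dim_col (mat_adjoint A) = dim_row A"
  by (auto simp: mat_adjoint_def)

lemma index_mat_adjoint [simp]:
  fixes A :: "complex mat"
  shows "i < dim_col A \<Longrightarrow> j < dim_row A \<Longrightarrow> mat_adjoint A $$ (i, j) = cnj (A $$ (j, i))"
  by (simp add: mat_adjoint_def mat_of_rows_def)

lemma cscalar_prod_mat_adjoint:
  fixes A :: "complex mat"
  assumes "A \<in> carrier_mat D D" "v \<in> carrier_vec D" "w \<in> carrier_vec D"
  shows "(mat_adjoint A *\<^sub>v v) \<bullet>c w = v \<bullet>c (A *\<^sub>v w)"
proof -
  have "(mat_adjoint A *\<^sub>v v) \<bullet>c w = (\<Sum>i<D. \<Sum>j<D. cnj (A $$ (j, i)) * v $ j * cnj (w $ i))"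
    using assms by (simp add: scalar_prod_def sum_distrib_right lessThan_atLeast0)
  also have "\<dots> = (\<Sum>j<D. \<Sum>i<D. cnj (A $$ (j, i)) * v $ j * cnj (w $ i))"
    by (rule sum.swap)
  also have "\<dots> = v \<bullet>c (A *\<^sub>v w)"
    using assms by (simp add: scalar_prod_def sum_distrib_left lessThan_atLeast0 mult_ac)
  finally show ?thesis .
qed

lemma mat_trace_mult:
  assumes "A \<in> carrier_mat a b" "B \<in> carrier_mat b a"
  shows "mat_trace (A * B) = (\<Sum>i<a. \<Sum>k<b. A $$ (i, k) * B $$ (k, i))"
  using assms by (simp add: mat_trace_def scalar_prod_def lessThan_atLeast0)

lemma mat_trace_comm:
  assumes "A \<in> carrier_mat a b" "B \<in> carrier_mat b a"
  shows "mat_trace (A * B) = mat_trace (B * A)"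
  unfolding mat_trace_mult[OF assms] mat_trace_mult[OF assms(2,1)]
  by (subst sum.swap) (simp add: mult.commute)

lemma mat_trace_minus:
  assumes "A \<in> carrier_mat D D" "B \<in> carrier_mat D D"
  shows "mat_trace (A - B) = mat_trace A - mat_trace B"
  using assms by (simp add: mat_trace_def sum_subtractf)

lemma one_minus_mult_mat:
  fixes A :: "complex mat"
  assumes "A \<in> carrier_mat D D" "B \<in> carrier_mat D D"
  shows "(1\<^sub>m D - A) * B = B - A * B"
  using assms minus_mult_distrib_mat[OF one_carrier_mat assms] by simp


section \<open>Projections\<close>

text \<open>These are the orthogonal projections. Such an operator can serve both as a measurement
  operator and as its own POVM element, because \<open>mat_adjoint A * A = A\<close>.\<close>

definition projection_mat :: "nat \<Rightarrow> complex mat \<Rightarrow> bool" where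
  "projection_mat D A \<longleftrightarrow> A \<in> carrier_mat D D \<and> mat_adjoint A = A \<and> A * A = A"

lemma projection_mat_one: "projection_mat D (1\<^sub>m D)"
  by (auto simp: projection_mat_def intro!: eq_matI)

lemma projection_mat_complement:
  assumes "projection_mat D A"
  shows "projection_mat D (1\<^sub>m D - A)"
proof -
  have A: "A \<in> carrier_mat D D" "mat_adjoint A = A" "A * A = A"
    using assms by (auto simp: projection_mat_def)
  have "mat_adjoint (1\<^sub>m D - A) $$ (i, j) = (1\<^sub>m D - A) $$ (i, j)" if "i < D" "j < D" for i j
  proof -
    have "cnj (A $$ (j, i)) = A $$ (i, j)"
      using index_mat_adjoint[of i A j] A that by simp
    with that A(1) show ?thesis by simp
  qed
  then have "mat_adjoint (1\<^sub>m D - A) = 1\<^sub>m D - A"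
    using A(1) by (intro eq_matI) auto
  moreover have "(1\<^sub>m D - A) * (1\<^sub>m D - A) = 1\<^sub>m D - A"
  proof -
    have "A * (1\<^sub>m D - A) = A - A"
      using A mult_minus_distrib_mat[OF A(1) one_carrier_mat A(1)] by simp
    then have "(1\<^sub>m D - A) * (1\<^sub>m D - A) = (1\<^sub>m D - A) - (A - A)"
      using one_minus_mult_mat[OF A(1), of "1\<^sub>m D - A"] A(1)
      by (simp add: minus_carrier_mat)
    also have "\<dots> = 1\<^sub>m D - A"
      using A(1) by (intro eq_matI) auto
    finally show ?thesis .
  qed
  ultimately show ?thesis
    using A(1) by (simp add: projection_mat_def minus_carrier_mat)
qed

text \<open>Since \<open>A\<close> equals \<open>mat_adjoint A * A\<close>, the quadratic form at
  \<open>v\<close> is the squared norm of \<open>A *\<^sub>v v\<close>.\<close>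

lemma positive_projection_mat:
  assumes "projection_mat D A"
  shows "positive_mat D A"
  unfolding positive_mat_def
proof (intro conjI ballI)
  show A: "A \<in> carrier_mat D D"
    using assms by (simp add: projection_mat_def)
  fix v :: "complex vec" assume v: "v \<in> carrier_vec D"
  have "(A *\<^sub>v v) \<bullet>c v = (mat_adjoint A *\<^sub>v (A *\<^sub>v v)) \<bullet>c v"
    using assms A v by (metis assoc_mult_mat_vec projection_mat_def)
  also have "\<dots> = (A *\<^sub>v v) \<bullet>c (A *\<^sub>v v)"
    using A v by (intro cscalar_prod_mat_adjoint) auto
  finally show "0 \<le> (A *\<^sub>v v) \<bullet>c v"
    by (simp add: conjugate_square_ge_0_vec)
qed

text \<open>Cyclicity moves the right-hand factor to the left, where idempotence absorbs it. This
  puts the trace of an unnormalized post-measurement state into Born-rule form.\<close>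

lemma mat_trace_sandwich:
  assumes "projection_mat D A" "\<rho> \<in> carrier_mat D D"
  shows "mat_trace (A * \<rho> * mat_adjoint A) = mat_trace (A * \<rho>)"
proof -
  have A: "A \<in> carrier_mat D D" "mat_adjoint A = A" "A * A = A"
    using assms by (auto simp: projection_mat_def)
  have "mat_trace (A * \<rho> * A) = mat_trace (A * (A * \<rho>))"
    using A assms(2) by (intro mat_trace_comm) auto
  also have "A * (A * \<rho>) = A * \<rho>"
    using A assms(2) by (metis assoc_mult_mat)
  finally show ?thesis using A by simp
qed

lemma rank_one_op_carrier [simp]: "v \<in> carrier_vec D \<Longrightarrow> rank_one_op v \<in> carrier_mat D D"
  by (simp add: rank_one_op_def)

text \<open>In v v* v v* the inner v* v is a scalar, the squared norm of v, which is also the trace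
  of v v*.\<close>

lemma rank_one_op_square:
  "rank_one_op v * rank_one_op v = mat_trace (rank_one_op v) \<cdot>\<^sub>m rank_one_op v"
  by (rule eq_matI)
    (auto simp: rank_one_op_def mat_trace_def scalar_prod_def lessThan_atLeast0
      sum_distrib_right sum_distrib_left mult_ac intro!: sum.cong)

text \<open>The factors of a product vector need not be unit vectors, so local projections are
  obtained by dividing by the squared norm.\<close>

lemma projection_normalized_rank_one_op:
  assumes "v \<in> carrier_vec D" "mat_trace (rank_one_op v) \<noteq> 0"
  shows "projection_mat D (inverse (mat_trace (rank_one_op v)) \<cdot>\<^sub>m rank_one_op v)"
proof -
  let ?R = "rank_one_op v" and ?s = "mat_trace (rank_one_op v)"
  have R: "?R \<in> carrier_mat D D" using assms by simp
  \<comment> \<open>The trace is a sum of squared moduli, hence real, so rescaling by its inverse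
    keeps the operator self-adjoint.\<close>
  have "cnj ?s = ?s"
    by (simp add: mat_trace_def rank_one_op_def mult.commute)
  then have "mat_adjoint (inverse ?s \<cdot>\<^sub>m ?R) = inverse ?s \<cdot>\<^sub>m ?R"
    using assms(1) by (intro eq_matI) (auto simp: rank_one_op_def)
  moreover have "(inverse ?s \<cdot>\<^sub>m ?R) * (inverse ?s \<cdot>\<^sub>m ?R) = inverse ?s \<cdot>\<^sub>m (inverse ?s \<cdot>\<^sub>m (?R * ?R))"
    using R by (simp add: mult_smult_distrib[of _ D D _ D] mult_smult_assoc_mat[of _ D D _ D])
  then have "(inverse ?s \<cdot>\<^sub>m ?R) * (inverse ?s \<cdot>\<^sub>m ?R) = inverse ?s \<cdot>\<^sub>m ?R"
    using assms(2) unfolding rank_one_op_square by (intro eq_matI) auto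
  ultimately show ?thesis
    using R by (simp add: projection_mat_def)
qed


section \<open>Kronecker products\<close>

lemma div_mod_less_mult:
  fixes i a b :: nat
  assumes "i < a * b"
  shows "i div b < a" "i mod b < b"
proof -
  have "0 < b" using assms by (cases "b = 0") auto
  then show "i div b < a" "i mod b < b"
    using assms by (auto simp: less_mult_imp_div_less)
qed

text \<open>The range below \<open>a * b\<close> is cut into \<open>a\<close> consecutive blocks of
  length \<open>b\<close>. Sums over a joint Kronecker index thereby become double sums over the
  local indices.\<close>

lemma sum_div_mod:
  fixes f :: "nat \<Rightarrow> nat \<Rightarrow> 'a::comm_monoid_add"
  shows "(\<Sum>i<a * b. f (i div b) (i mod b)) = (\<Sum>x<a. \<Sum>y<b. f x y)"
proof -
  have "(\<Sum>x<a. \<Sum>y<b. f x y) = (\<Sum>x<a. \<Sum>i\<in>{x * b..<x * b + b}. f (i div b) (i mod b))"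
  proof (rule sum.cong[OF refl])
    fix x
    have "(\<Sum>y<b. f x y) = (\<Sum>y<b. f ((y + x * b) div b) ((y + x * b) mod b))"
      by (intro sum.cong) auto
    also have "\<dots> = (\<Sum>i\<in>{x * b..<x * b + b}. f (i div b) (i mod b))"
      using sum.shift_bounds_nat_ivl[of "\<lambda>i. f (i div b) (i mod b)" 0 "x * b" b]
      by (simp add: lessThan_atLeast0 add.commute)
    finally show "(\<Sum>y<b. f x y) = (\<Sum>i\<in>{x * b..<x * b + b}. f (i div b) (i mod b))" .
  qed
  also have "\<dots> = (\<Sum>i<a * b. f (i div b) (i mod b))"
    by (rule sum.nat_group)
  finally show ?thesis ..
qed

lemma kron_mat_carrier [simp]:
  "A \<in> carrier_mat a b \<Longrightarrow> B \<in> carrier_mat p q \<Longrightarrow> kron_mat A B \<in> carrier_mat (a * p) (b * q)"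
  by (simp add: kron_mat_def)

lemma dim_kron_mat [simp]:
  "dim_row (kron_mat A B) = dim_row A * dim_row B"
  "dim_col (kron_mat A B) = dim_col A * dim_col B"
  by (simp_all add: kron_mat_def)

lemma index_kron_mat [simp]:
  assumes "i < dim_row A * dim_row B" "j < dim_col A * dim_col B"
  shows "kron_mat A B $$ (i, j) =
    A $$ (i div dim_row B, j div dim_col B) * B $$ (i mod dim_row B, j mod dim_col B)"
  using assms by (simp add: kron_mat_def)

text \<open>The inner summation index splits into one index per factor, and the double sum then
  separates into a product of two sums.\<close>

lemma kron_mat_mult:
  assumes "A \<in> carrier_mat a b" "B \<in> carrier_mat p q" "C \<in> carrier_mat b c" "E \<in> carrier_mat q r"
  shows "kron_mat A B * kron_mat C E = kron_mat (A * C) (B * E)"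
proof (rule eq_matI)
  fix i j assume "i < dim_row (kron_mat (A * C) (B * E))" "j < dim_col (kron_mat (A * C) (B * E))"
  with assms have i: "i < a * p" and j: "j < c * r" by auto
  note ij = div_mod_less_mult[OF i] div_mod_less_mult[OF j]
  have "(kron_mat A B * kron_mat C E) $$ (i, j) = (\<Sum>k<b * q. kron_mat A B $$ (i, k) * kron_mat C E $$ (k, j))"
    using assms i j by (simp add: scalar_prod_def lessThan_atLeast0)
  also have "\<dots> = (\<Sum>k<b * q. (\<lambda>x y. (A $$ (i div p, x) * B $$ (i mod p, y)) *
      (C $$ (x, j div r) * E $$ (y, j mod r))) (k div q) (k mod q))"
    using assms i j by (intro sum.cong) auto
  also have "\<dots> = (\<Sum>x<b. \<Sum>y<q. (A $$ (i div p, x) * B $$ (i mod p, y)) *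
      (C $$ (x, j div r) * E $$ (y, j mod r)))"
    by (rule sum_div_mod)
  also have "\<dots> = (\<Sum>x<b. A $$ (i div p, x) * C $$ (x, j div r)) *
      (\<Sum>y<q. B $$ (i mod p, y) * E $$ (y, j mod r))"
    by (simp add: sum_product mult_ac)
  also have "\<dots> = kron_mat (A * C) (B * E) $$ (i, j)"
    using assms i j ij by (simp add: scalar_prod_def lessThan_atLeast0)
  finally show "(kron_mat A B * kron_mat C E) $$ (i, j) = kron_mat (A * C) (B * E) $$ (i, j)" .
qed (use assms in auto)

lemma mat_adjoint_kron_mat: "mat_adjoint (kron_mat A B) = kron_mat (mat_adjoint A) (mat_adjoint B)"
  by (rule eq_matI) (auto simp: div_mod_less_mult)

lemma mat_trace_kron_mat:
  assumes "A \<in> carrier_mat a a" "B \<in> carrier_mat b b"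
  shows "mat_trace (kron_mat A B) = mat_trace A * mat_trace B"
proof -
  have "mat_trace (kron_mat A B) =
      (\<Sum>i<a * b. (\<lambda>x y. A $$ (x, x) * B $$ (y, y)) (i div b) (i mod b))"
    using assms by (simp add: mat_trace_def)
  also have "\<dots> = (\<Sum>x<a. \<Sum>y<b. A $$ (x, x) * B $$ (y, y))"
    by (rule sum_div_mod)
  finally show ?thesis
    using assms by (simp add: mat_trace_def sum_product)
qed

text \<open>An index is determined by its quotient and remainder, so a joint entry is diagonal
  exactly when both local entries are.\<close>

lemma kron_mat_one: "kron_mat (1\<^sub>m a) (1\<^sub>m b) = 1\<^sub>m (a * b)"
proof (rule eq_matI)
  fix i j assume "i < dim_row (1\<^sub>m (a * b))" "j < dim_col (1\<^sub>m (a * b))"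
  then have i: "i < a * b" and j: "j < a * b" by auto
  have "i = j \<longleftrightarrow> i div b = j div b \<and> i mod b = j mod b"
    by (metis div_mult_mod_eq)
  then show "kron_mat (1\<^sub>m a) (1\<^sub>m b) $$ (i, j) = 1\<^sub>m (a * b) $$ (i, j)"
    using i j div_mod_less_mult[OF i] div_mod_less_mult[OF j] by auto
qed auto

lemma kron_mat_minus_left:
  assumes "A \<in> carrier_mat a b" "A' \<in> carrier_mat a b"
  shows "kron_mat (A - A') B = kron_mat A B - kron_mat A' B"
  using assms by (intro eq_matI) (auto simp: div_mod_less_mult algebra_simps)

lemma kron_mat_minus_right:
  assumes "B \<in> carrier_mat a b" "B' \<in> carrier_mat a b"
  shows "kron_mat A (B - B') = kron_mat A B - kron_mat A B'"
  using assms by (intro eq_matI) (auto simp: div_mod_less_mult algebra_simps)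

lemma kron_mat_smult: "kron_mat (a \<cdot>\<^sub>m A) (b \<cdot>\<^sub>m B) = (a * b) \<cdot>\<^sub>m kron_mat A B"
  by (rule eq_matI) (auto simp: div_mod_less_mult)

lemma rank_one_op_kron_vec: "rank_one_op (kron_vec v w) = kron_mat (rank_one_op v) (rank_one_op w)"
  by (rule eq_matI) (auto simp: rank_one_op_def kron_vec_def div_mod_less_mult)


section \<open>Tensor products of finitely many operators\<close>

lemma total_dim_0 [simp]: "total_dim 0 d = 1"
  by (simp add: total_dim_def)

lemma total_dim_Suc [simp]: "total_dim (Suc n) d = total_dim n d * d n"
  by (simp add: total_dim_def)

lemma tensor_mat_carrier:
  "(\<And>l. l < n \<Longrightarrow> A l \<in> carrier_mat (d l) (d l)) \<Longrightarrow>
    tensor_mat n A \<in> carrier_mat (total_dim n d) (total_dim n d)"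
  by (induction n) simp_all

lemma tensor_mat_cong:
  "(\<And>l. l < n \<Longrightarrow> A l = B l) \<Longrightarrow> tensor_mat n A = tensor_mat n B"
  by (induction n) simp_all

lemma tensor_mat_one: "tensor_mat n (\<lambda>l. 1\<^sub>m (d l)) = 1\<^sub>m (total_dim n d)"
  by (induction n) (simp_all add: kron_mat_one)

lemma tensor_mat_mult:
  assumes "\<And>l. l < n \<Longrightarrow> A l \<in> carrier_mat (d l) (d l)" "\<And>l. l < n \<Longrightarrow> B l \<in> carrier_mat (d l) (d l)"
  shows "tensor_mat n A * tensor_mat n B = tensor_mat n (\<lambda>l. A l * B l)"
  using assms
proof (induction n)
  case (Suc n)
  have "kron_mat (tensor_mat n A) (A n) * kron_mat (tensor_mat n B) (B n) =
      kron_mat (tensor_mat n A * tensor_mat n B) (A n * B n)"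
    using Suc.prems
    by (intro kron_mat_mult[of _ "total_dim n d" "total_dim n d" _ "d n" "d n" _ "total_dim n d" _ "d n"]
        tensor_mat_carrier) auto
  with Suc show ?case by simp
qed simp

lemma mat_adjoint_tensor_mat: "mat_adjoint (tensor_mat n A) = tensor_mat n (\<lambda>l. mat_adjoint (A l))"
proof (induction n)
  case 0
  show ?case by (auto intro!: eq_matI)
qed (simp add: mat_adjoint_kron_mat)

text \<open>The defining properties are inherited slot by slot. This covers the local operators, the
  intermediate operators of the induction on the protocol, and finally the state itself.\<close>

lemma projection_tensor_mat:
  assumes "\<And>l. l < n \<Longrightarrow> projection_mat (d l) (A l)"
  shows "projection_mat (total_dim n d) (tensor_mat n A)"
  using assms unfolding projection_mat_def
  by (simp add: tensor_mat_carrier mat_adjoint_tensor_mat tensor_mat_mult[where d = d]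
      cong: tensor_mat_cong)

lemma mat_trace_tensor_mat:
  assumes "\<And>l. l < n \<Longrightarrow> A l \<in> carrier_mat (d l) (d l)"
  shows "mat_trace (tensor_mat n A) = (\<Prod>l<n. mat_trace (A l))"
  using assms
proof (induction n)
  case 0
  show ?case by (simp add: mat_trace_def)
next
  case (Suc n)
  then show ?case
    using mat_trace_kron_mat[OF tensor_mat_carrier[of n A d], of "A n" "d n"] by simp
qed

lemma tensor_mat_smult: "tensor_mat n (\<lambda>l. c l \<cdot>\<^sub>m A l) = (\<Prod>l<n. c l) \<cdot>\<^sub>m tensor_mat n A"
proof (induction n)
  case 0
  show ?case by (auto intro!: eq_matI)
qed (simp add: kron_mat_smult)

lemma rank_one_op_tensor_vec: "rank_one_op (tensor_vec n \<xi>) = tensor_mat n (\<lambda>l. rank_one_op (\<xi> l))"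
proof (induction n)
  case 0
  show ?case by (auto simp: rank_one_op_def intro!: eq_matI)
qed (simp add: rank_one_op_kron_vec)

text \<open>A tensor product is linear in each slot, and only slot \<open>k\<close> varies here.
  Together with \<open>local_op_one\<close> this makes the operator of a failed local test the
  complement of that of a successful one.\<close>

lemma local_op_minus:
  assumes "k < n" "A \<in> carrier_mat (d k) (d k)" "B \<in> carrier_mat (d k) (d k)"
  shows "local_op n d k (A - B) = local_op n d k A - local_op n d k B"
  using assms(1)
proof (induction n)
  case (Suc n)
  let ?T = "\<lambda>C. tensor_mat n (\<lambda>l. if l = k then C else 1\<^sub>m (d l))"
  show ?case
  proof (cases "k = n")
    case True
    \<comment> \<open>The distinguished slot is the last one, so the first \<open>n\<close> slots
      hold identities whatever \<open>C\<close> is.\<close>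
    have "?T C = tensor_mat n (\<lambda>l. 1\<^sub>m (d l))" for C
      using True by (intro tensor_mat_cong) auto
    with True assms show ?thesis
      by (simp add: local_op_def kron_mat_minus_right)
  next
    case False
    have "?T A \<in> carrier_mat (total_dim n d) (total_dim n d)"
      "?T B \<in> carrier_mat (total_dim n d) (total_dim n d)"
      using assms by (auto intro!: tensor_mat_carrier)
    with False Suc show ?thesis
      by (simp add: local_op_def kron_mat_minus_left)
  qed
qed simp

lemma local_op_one: "local_op n d k (1\<^sub>m (d k)) = 1\<^sub>m (total_dim n d)"
proof -
  have "local_op n d k (1\<^sub>m (d k)) = tensor_mat n (\<lambda>l. 1\<^sub>m (d l))"
    unfolding local_op_def by (rule tensor_mat_cong) simp
  then show ?thesis by (simp add: tensor_mat_one)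
qed

lemma projection_local_op:
  assumes "projection_mat (d k) A"
  shows "projection_mat (total_dim n d) (local_op n d k A)"
  unfolding local_op_def
  using assms by (intro projection_tensor_mat) (auto simp: projection_mat_one)


section \<open>Measuring local projections one after another\<close>

text \<open>The numeral counts the parties still to be tested, so that they act in descending order
  and the recursion follows that of \<open>tensor_mat\<close>.\<close>

primrec authentication_protocol ::
  "(nat \<Rightarrow> nat) \<Rightarrow> (nat \<Rightarrow> complex mat) \<Rightarrow> nat \<Rightarrow> bool locc" where
  "authentication_protocol d Q 0 = Output True"
| "authentication_protocol d Q (Suc k) = Measure k 2 (\<lambda>a. if a = 0 then Q k else 1\<^sub>m (d k) - Q k)
     (\<lambda>a. if a = 0 then authentication_protocol d Q k else Output False)"

text \<open>The operators measured here are square, so the dimension update in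
  \<open>valid_locc\<close> and \<open>locc_prob\<close> leaves \<open>d\<close> unchanged.\<close>

lemma fun_upd_dim_row: "A \<in> carrier_mat (d k) (d k) \<Longrightarrow> d(k := dim_row A) = d"
  by auto

context
  fixes n :: nat and d :: "nat \<Rightarrow> nat" and Q :: "nat \<Rightarrow> complex mat"
  assumes Q: "\<And>l. l < n \<Longrightarrow> projection_mat (d l) (Q l)"
begin

lemma Q_carrier: "l < n \<Longrightarrow> Q l \<in> carrier_mat (d l) (d l)"
  using Q by (simp add: projection_mat_def)

lemma valid_authentication_protocol:
  "k \<le> n \<Longrightarrow> valid_locc n (authentication_protocol d Q k) d"
proof (induction k)
  case (Suc k)
  then have k: "k < n" by simp
  let ?C = "1\<^sub>m (d k) - Q k"
  have c: "Q k \<in> carrier_mat (d k) (d k)" "?C \<in> carrier_mat (d k) (d k)"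
    using Q_carrier[OF k] by auto
  \<comment> \<open>Both measurement operators are projections, so completeness reduces to
    \<open>Q k + (1 - Q k) = 1\<close>.\<close>
  have "mat_adjoint (Q k) * Q k = Q k" "mat_adjoint ?C * ?C = ?C"
    using Q[OF k] projection_mat_complement[OF Q[OF k]] by (simp_all add: projection_mat_def)
  then have "mat_sum (d k) (\<lambda>a. mat_adjoint (if a = 0 then Q k else ?C) * (if a = 0 then Q k else ?C))
      {..<2::nat} = 1\<^sub>m (d k)"
    using c by (intro eq_matI) (auto simp: mat_sum_def numeral_2_eq_2)
  moreover have "valid_locc n (authentication_protocol d Q k) (d(k := dim_row (Q k)))"
    using Suc fun_upd_dim_row[of _ d k, OF c(1)] by simp
  ultimately show ?case
    using c k by simp
qed simp

text \<open>This will be the POVM element for the answer \<open>True\<close> when only the parties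
  below \<open>k\<close> are tested.\<close>

definition partial_projection :: "nat \<Rightarrow> complex mat" where
  "partial_projection k = tensor_mat n (\<lambda>l. if l < k then Q l else 1\<^sub>m (d l))"

lemma projection_partial_projection: "projection_mat (total_dim n d) (partial_projection k)"
  unfolding partial_projection_def
  by (rule projection_tensor_mat) (auto simp: Q projection_mat_one)

text \<open>Products are taken slot by slot. In the first equation slot \<open>k\<close> still holds
  an identity, which is replaced by \<open>Q k\<close>; in the second it already holds
  \<open>Q k\<close>, which is idempotent.\<close>

lemma partial_projection_Suc:
  assumes "k < n"
  shows "partial_projection k * local_op n d k (Q k) = partial_projection (Suc k)"
    "local_op n d k (Q k) * partial_projection (Suc k) = partial_projection (Suc k)"
proof -
  have [simp]: "Q l * Q l = Q l" if "l < n" for l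
    using Q[OF that] by (simp add: projection_mat_def)
  show "partial_projection k * local_op n d k (Q k) = partial_projection (Suc k)"
    unfolding partial_projection_def local_op_def
    using assms
    by (subst tensor_mat_mult[where d = d])
      (auto simp: Q_carrier 
        left_mult_one_mat[OF Q_carrier] right_mult_one_mat[OF Q_carrier] intro!: tensor_mat_cong)
  show "local_op n d k (Q k) * partial_projection (Suc k) = partial_projection (Suc k)"
    unfolding partial_projection_def local_op_def
    using assms
    by (subst tensor_mat_mult[where d = d])
      (auto simp: Q_carrier 
        left_mult_one_mat[OF Q_carrier] right_mult_one_mat[OF Q_carrier] intro!: tensor_mat_cong)
qed

text \<open>Induction on the number of tests. The matrix is arbitrary rather than a density
  operator, since the recursion passes on unnormalized states.\<close>

lemma locc_prob_authentication_protocol: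
  assumes "k \<le> n" "\<rho> \<in> carrier_mat (total_dim n d) (total_dim n d)"
  shows "locc_prob n (authentication_protocol d Q k) d \<rho> True = mat_trace (partial_projection k * \<rho>)"
    "locc_prob n (authentication_protocol d Q k) d \<rho> False =
      mat_trace ((1\<^sub>m (total_dim n d) - partial_projection k) * \<rho>)"
proof -
  let ?D = "total_dim n d"
  \<comment> \<open>For \<open>False\<close> the induction carries a difference of traces, so that
    the contributions of the branches telescope; the complement is restored at the end.\<close>
  have "locc_prob n (authentication_protocol d Q k) d \<rho> True = mat_trace (partial_projection k * \<rho>) \<and>
    locc_prob n (authentication_protocol d Q k) d \<rho> False = mat_trace \<rho> - mat_trace (partial_projection k * \<rho>)"
    using assms
  proof (induction k arbitrary: \<rho>)
    case 0
    then show ?case by (simp add: partial_projection_def tensor_mat_one)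
  next
    case (Suc k)
    then have k: "k < n" by simp
    let ?C = "1\<^sub>m (d k) - Q k"
    let ?L = "local_op n d k (Q k)" and ?L' = "local_op n d k ?C"
    let ?P = "partial_projection k" and ?P' = "partial_projection (Suc k)"
    let ?\<sigma> = "?L * \<rho> * mat_adjoint ?L"
    note c = Q_carrier[OF k]
    have L: "projection_mat ?D ?L" "projection_mat ?D ?L'"
      using Q[OF k] by (auto intro!: projection_local_op projection_mat_complement)
    have car: "?L \<in> carrier_mat ?D ?D" "?P \<in> carrier_mat ?D ?D" "?P' \<in> carrier_mat ?D ?D"
      using L projection_partial_projection by (auto simp: projection_mat_def)
    note \<rho> = Suc.prems(2)
    have \<sigma>: "?\<sigma> \<in> carrier_mat ?D ?D"
      using car \<rho> by (meson mat_adjoint_carrier mult_carrier_mat)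
    have "?L' = 1\<^sub>m ?D - ?L"
      using k c by (simp add: local_op_minus local_op_one)
    \<comment> \<open>The weight of the branch in which party \<open>k\<close> fails, where
      \<open>False\<close> is announced at once.\<close>
    then have no: "mat_trace (?L' * \<rho> * mat_adjoint ?L') = mat_trace \<rho> - mat_trace (?L * \<rho>)"
      using mat_trace_sandwich[OF L(2) \<rho>] car \<rho>
      by (simp add: one_minus_mult_mat mat_trace_minus[of _ ?D])
    \<comment> \<open>The left copy of \<open>?L\<close> extends \<open>?P\<close> to
      \<open>?P'\<close>; the right copy is brought round by cyclicity and absorbed by
      \<open>?P'\<close>.\<close>
    have "?P * ?\<sigma> = ?P * (?L * \<rho>) * ?L"
      using car \<rho> L(1) assoc_mult_mat[of ?P ?D ?D "?L * \<rho>" ?D ?L ?D] by (simp add: projection_mat_def)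
    also have "?P * (?L * \<rho>) = ?P' * \<rho>"
      using assoc_mult_mat[OF car(2,1) \<rho>] partial_projection_Suc(1)[OF k] by simp
    finally have "mat_trace (?P * ?\<sigma>) = mat_trace (?P' * \<rho> * ?L)"
      by simp
    also have "\<dots> = mat_trace (?L * (?P' * \<rho>))"
      using car \<rho> by (intro mat_trace_comm) auto
    also have "?L * (?P' * \<rho>) = ?P' * \<rho>"
      using assoc_mult_mat[OF car(1,3) \<rho>] partial_projection_Suc(2)[OF k] by simp
    finally have yes: "mat_trace (?P * ?\<sigma>) = mat_trace (?P' * \<rho>)" .
    have IH: "locc_prob n (authentication_protocol d Q k) d ?\<sigma> True = mat_trace (?P * ?\<sigma>)"
      "locc_prob n (authentication_protocol d Q k) d ?\<sigma> False = mat_trace ?\<sigma> - mat_trace (?P * ?\<sigma>)"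
      using Suc.IH[OF _ \<sigma>] Suc.prems(1) by simp_all
    \<comment> \<open>The trace of \<open>?\<sigma>\<close> is that of \<open>?L * \<rho>\<close>,
      which cancels against the term subtracted in \<open>no\<close>.\<close>
    show ?case
      using no by (simp add: numeral_2_eq_2 fun_upd_dim_row[of _ d k, OF c] IH yes
          mat_trace_sandwich[OF L(1) \<rho>])
  qed
  moreover have "mat_trace ((1\<^sub>m ?D - partial_projection k) * \<rho>) =
      mat_trace \<rho> - mat_trace (partial_projection k * \<rho>)"
    using projection_partial_projection assms(2)
    by (simp add: projection_mat_def one_minus_mult_mat mat_trace_minus[of _ ?D] mult_carrier_mat[of _ ?D ?D])
  ultimately show "locc_prob n (authentication_protocol d Q k) d \<rho> True = mat_trace (partial_projection k * \<rho>)"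
    "locc_prob n (authentication_protocol d Q k) d \<rho> False =
      mat_trace ((1\<^sub>m ?D - partial_projection k) * \<rho>)"
    by simp_all
qed

text \<open>With all \<open>n\<close> parties tested, \<open>partial_projection n\<close> is the
  full tensor product, so the protocol reproduces the statistics of \<open>M\<close>.\<close>

lemma projective_measurement_locc_implementable:
  fixes M :: "bool \<Rightarrow> complex mat"
  defines "M \<equiv> \<lambda>x. if x then tensor_mat n Q else 1\<^sub>m (total_dim n d) - tensor_mat n Q"
  shows "povm (total_dim n d) M" "locc_implementable n d M"
proof -
  let ?D = "total_dim n d"
  have P: "projection_mat ?D (tensor_mat n Q)"
    using Q by (rule projection_tensor_mat)
  have "positive_mat ?D (M x)" for x
    unfolding M_def using P by (auto intro!: positive_projection_mat projection_mat_complement)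
  moreover have "mat_sum ?D M UNIV = 1\<^sub>m ?D"
    using P by (intro eq_matI) (auto simp: mat_sum_def M_def UNIV_bool projection_mat_def)
  ultimately show "povm ?D M" by (simp add: povm_def)
  have "partial_projection n = tensor_mat n Q"
    unfolding partial_projection_def by (rule tensor_mat_cong) simp
  then have "locc_prob n (authentication_protocol d Q n) d \<rho> x = mat_trace (M x * \<rho>)"
    if "density_op ?D \<rho>" for \<rho> x
    using locc_prob_authentication_protocol[of n \<rho>] that
    by (cases x) (auto simp: M_def density_op_def positive_mat_def)
  with valid_authentication_protocol[of n] show "locc_implementable n d M"
    unfolding locc_implementable_def by blast
qed

end

theorem theorem2:
  fixes n N j :: nat and d :: "nat \<Rightarrow> nat"
    and \<rho> :: "nat \<Rightarrow> complex mat" and \<xi> :: "nat \<Rightarrow> complex vec"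
  assumes "n \<ge> 2"
    and "\<And>i. i < N \<Longrightarrow> density_op (total_dim n d) (\<rho> i)"
    and "\<And>i i'. i < N \<Longrightarrow> i' < N \<Longrightarrow> i \<noteq> i' \<Longrightarrow> orthogonal_states (\<rho> i) (\<rho> i')"
    and "j < N"
    and "\<And>k. k < n \<Longrightarrow> \<xi> k \<in> carrier_vec (d k)"
    and "\<rho> j = rank_one_op (tensor_vec n \<xi>)"
  shows "locally_authenticable n d N \<rho> j"
proof -
  \<comment> \<open>The squared norms of the local vectors. Only their product is known to be 1, by
    comparing with the trace of the state \<open>\<rho> j\<close>.\<close>
  define s where "s k = mat_trace (rank_one_op (\<xi> k))" for k
  define Q where "Q k = inverse (s k) \<cdot>\<^sub>m rank_one_op (\<xi> k)" for k
  have tr: "mat_trace (\<rho> j) = 1"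
    using assms(2,4) by (simp add: density_op_def)
  have "mat_trace (\<rho> j) = (\<Prod>k<n. s k)"
    unfolding assms(6) rank_one_op_tensor_vec s_def
    using assms(5) by (intro mat_trace_tensor_mat[where d = d]) simp
  with tr have prod_s: "(\<Prod>k<n. s k) = 1" by simp
  then have "s k \<noteq> 0" if "k < n" for k
    using that by (metis finite_lessThan lessThan_iff prod_zero_iff zero_neq_one)
  then have Q: "projection_mat (d k) (Q k)" if "k < n" for k
    unfolding Q_def s_def using that assms(5)
    by (intro projection_normalized_rank_one_op) (auto simp: s_def)
  \<comment> \<open>The local normalization constants collect into the inverse of a product equal to
    1, so normalizing each factor leaves the global operator unchanged.\<close>
  have "tensor_mat n Q = inverse (\<Prod>k<n. s k) \<cdot>\<^sub>m \<rho> j"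
    unfolding Q_def tensor_mat_smult assms(6) rank_one_op_tensor_vec by (simp add: o_def flip: prod_inversef)
  also have "\<dots> = \<rho> j"
    unfolding prod_s by (auto intro!: eq_matI)
  finally have \<rho>j: "tensor_mat n Q = \<rho> j" .
  let ?M = "\<lambda>x. if x then tensor_mat n Q else 1\<^sub>m (total_dim n d) - tensor_mat n Q"
  \<comment> \<open>As a tensor product of projections, \<open>\<rho> j\<close> is idempotent, so
    its square has the trace of a state.\<close>
  have "mat_trace (\<rho> j * \<rho> j) = 1"
    using projection_tensor_mat[of n d Q, OF Q] tr unfolding \<rho>j by (simp add: projection_mat_def)
  moreover have "mat_trace (\<rho> j * \<rho> i) = 0" if "i < N" "i \<noteq> j" for i
    using assms(3)[of j i] assms(4) that by (simp add: orthogonal_states_def)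
  ultimately show ?thesis
    unfolding locally_authenticable_def
    using projective_measurement_locc_implementable[of n d Q, OF Q] \<rho>j
    by (intro exI[of _ ?M]) simp
qed

end
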